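(* Let $\alpha\in(2,3)$, $\delta\in(0,\pi]$, $\omega\in(0,1/2)$, and let $$\lambda_\delta(n)=2(3-\alpha)\,\delta^{-(3-\alpha)}\,n^{\alpha-1}\int_0^{n\delta}\frac{1-\cos t}{t^\alpha}\,dt,\qquad n>0,$$ be the eigenvalues of the nonlocal operator with power kernel. Let $$F(N;\delta,\omega)=\sum_{m=1}^\infty\frac{1}{\lambda_\delta(mN)}\left(\frac{\sin(m\pi\omega)}{m}\right)^2,\qquad \Delta_NF(N;\delta,\omega)=F(N+1;\delta,\omega)-F(N;\delta,\omega),$$ and for $\gamma>0$ let $N^*=N^*(\gamma,\delta)$ be the largest minimizer over $N\in\mathbb{Z}^+$ of $2N+\frac{2\gamma}{\pi}F(N;\delta,\omega)$. If $N^*(\gamma,\delta)$ is sufficiently large (that is, there is an $N_0$ such that whenever $N^*(\gamma,\delta)\ge N_0$), then $$\frac{\partial}{\partial\delta}\Delta_NF(N^*-1;\delta,\omega)\le0,\qquad \frac{\partial}{\partial\delta}\Delta_NF(N^*;\delta,\omega)\le0,$$ and $\delta$ instantly promotes the bubble splitting.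
   Context: The power kernel is $\rho_\delta(s)=\frac{3-\alpha}{\delta^{3-\alpha}|s|^\alpha}$, $0<|s|\le\delta$. The partial derivative in $\delta$ is taken with the integer argument held fixed and then evaluated at $N=N^*(\gamma,\delta)$, respectively $N=N^*(\gamma,\delta)-1$. By definition, the bubble splitting is "instantly promoted" by $\delta$ if $\frac{\partial}{\partial\delta}\Delta_NF(N;\delta,\omega)\le0$ at $N=N^*-1$ and $N=N^*$. The threshold $N_0$ may depend on $\alpha,\delta$ (and $\omega$). *)

theory Defs
  imports "HOL-Analysis.Analysis"
begin

(* Substituting t = n s gives the Fourier symbol
     eigval alpha delta n = integral of rho_delta(s) (1 - cos (n s)) over 0 < |s| <= delta
   of the nonlocal operator with power kernel
     rho_delta(s) = (3 - alpha) / (delta powr (3 - alpha) * |s| powr alpha).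
   For 2 < alpha < 3 the integrand is unbounded but integrable at 0. *)
definition eigval :: "real \<Rightarrow> real \<Rightarrow> real \<Rightarrow> real" where
  "eigval \<alpha> \<delta> n =
     2 * (3 - \<alpha>) * \<delta> powr (- (3 - \<alpha>)) * n powr (\<alpha> - 1)
       * integral {0..n * \<delta>} (\<lambda>t. (1 - cos t) / t powr \<alpha>)"

(* The series runs over m = 1, 2, ...; the summation index is shifted by one. *)
definition F :: "real \<Rightarrow> nat \<Rightarrow> real \<Rightarrow> real \<Rightarrow> real" where
  "F \<alpha> N \<delta> \<omega> =
     (\<Sum>k. 1 / eigval \<alpha> \<delta> (real (Suc k) * real N)
            * (sin (real (Suc k) * pi * \<omega>) / real (Suc k))\<^sup>2)"

definition DeltaF :: "real \<Rightarrow> nat \<Rightarrow> real \<Rightarrow> real \<Rightarrow> real" where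
  "DeltaF \<alpha> N \<delta> \<omega> = F \<alpha> (N + 1) \<delta> \<omega> - F \<alpha> N \<delta> \<omega>"

(* Partial derivative in delta with the integer N held fixed. *)
definition dDeltaF :: "real \<Rightarrow> nat \<Rightarrow> real \<Rightarrow> real \<Rightarrow> real" where
  "dDeltaF \<alpha> N \<delta> \<omega> = deriv (\<lambda>d. DeltaF \<alpha> N d \<omega>) \<delta>"

definition energy :: "real \<Rightarrow> real \<Rightarrow> real \<Rightarrow> real \<Rightarrow> nat \<Rightarrow> real" where
  "energy \<alpha> \<omega> \<gamma> \<delta> N = 2 * real N + 2 * \<gamma> / pi * F \<alpha> N \<delta> \<omega>"

definition Nstar :: "real \<Rightarrow> real \<Rightarrow> real \<Rightarrow> real \<Rightarrow> nat" where
  "Nstar \<alpha> \<omega> \<gamma> \<delta> =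
     (GREATEST N. is_arg_min (energy \<alpha> \<omega> \<gamma> \<delta>) (\<lambda>M. 1 \<le> M) N)"

(* deriv is unspecified where the derivative does not exist, so existence is required here.
   Meaningful for Nstar >= 2 only: F is not defined at N = 0 (division by zero). *)
definition instantly_promotes :: "real \<Rightarrow> real \<Rightarrow> real \<Rightarrow> real \<Rightarrow> bool" where
  "instantly_promotes \<alpha> \<omega> \<gamma> \<delta> \<longleftrightarrow>
     (\<forall>N \<in> {Nstar \<alpha> \<omega> \<gamma> \<delta> - 1, Nstar \<alpha> \<omega> \<gamma> \<delta>}.
        (\<lambda>d. DeltaF \<alpha> N d \<omega>) field_differentiable (at \<delta>) \<and> dDeltaF \<alpha> N \<delta> \<omega> \<le> 0)"

end

theory Submission
  imports Defs
begin

text \<open>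
  Write \<open>I(x)\<close> for the integral of \<open>(1 - cos t) / t^\<alpha>\<close> over \<open>[0, x]\<close>. Up to constants the reciprocal
  eigenvalue is \<open>\<delta>^(3-\<alpha>) n^(1-\<alpha>) / I(n\<delta>)\<close>, and its derivative in \<open>\<delta>\<close> is
  \<open>\<delta>^(2-\<alpha>) n^(1-\<alpha>) P(n\<delta>)\<close> with \<open>P(x) = (3-\<alpha>) / I(x) - x^(1-\<alpha>) (1 - cos x) / I(x)^2\<close>.
  The oscillation of \<open>P\<close> looks dangerous, but it has small amplitude: since \<open>I\<close> increases to a finite
  limit \<open>L > 0\<close> with error \<open>O(x^(1-\<alpha>))\<close>, also \<open>P(x) = (3-\<alpha>) / L + O(x^(1-\<alpha>))\<close>
  (\<open>profile_asymptotics\<close>).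

  Differentiating the series for \<open>F\<close> term by term (\<open>F_has_derivative\<close>) and inserting this expansion
  at \<open>n = m N\<close> shows that the derivative of \<open>F\<close> in \<open>\<delta>\<close> is \<open>A N^(1-\<alpha>) + O(N^(2(1-\<alpha>)))\<close> with
  \<open>A > 0\<close> (\<open>dF_asymptotics\<close>). The difference in \<open>N\<close> of the main term is negative of order \<open>N^(-\<alpha>)\<close>.
  The error term is estimated without exploiting any cancellation between \<open>N\<close> and \<open>N + 1\<close>, and
  this suffices because \<open>2(1-\<alpha>) < -\<alpha>\<close> exactly when \<open>\<alpha> > 2\<close> (\<open>eventually_increment_nonpos\<close>).
  So the mixed derivative is nonpositive at every sufficiently large \<open>N\<close>, in particular at
  \<open>N\<^sup>* - 1\<close> and \<open>N\<^sup>*\<close> once \<open>N\<^sup>*\<close> is large.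
\<close>

section \<open>The truncated oscillatory integral\<close>

definition osc_int :: "real \<Rightarrow> real \<Rightarrow> real" where
  "osc_int \<alpha> x = integral {0..x} (\<lambda>t. (1 - cos t) / t powr \<alpha>)"

text \<open>
  The improper integral over \<open>[0, \<infinity>)\<close>. As the truncated integrals increase with the upper limit,
  a supremum represents it and gives both \<open>osc_int_le_limit\<close> and \<open>osc_limit_le\<close> by order arguments.
\<close>
definition osc_limit :: "real \<Rightarrow> real" where
  "osc_limit \<alpha> = (SUP x\<in>{1..}. osc_int \<alpha> x)"

lemma one_minus_cos_le_half_square: "1 - cos (t::real) \<le> t\<^sup>2 / 2"
proof -
  have "1 - cos t = 2 * (sin (t/2))\<^sup>2"
    using cos_double_sin[of "t/2"] by simp
  also have "\<dots> \<le> 2 * (t/2)\<^sup>2"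
    using abs_sin_x_le_abs_x[of "t/2"] by (simp only: abs_le_square_iff)
  finally show ?thesis by (simp add: power2_eq_square)
qed

text \<open>
  Near \<open>0\<close> the numerator vanishes to second order, so the integrand is dominated by
  \<open>t powr (2 - \<alpha>)\<close>, whose exponent exceeds \<open>- 1\<close>.
\<close>
lemma osc_integrable:
  assumes "(\<alpha>::real) < 3"
  shows "(\<lambda>t. (1 - cos t) / t powr \<alpha>) integrable_on {0..x}"
proof (cases "0 \<le> x")
  case True
  show ?thesis
  proof (rule measurable_bounded_by_integrable_imp_integrable_real)
    have "(\<lambda>t::real. (1 - cos t) / t powr \<alpha>) \<in> borel_measurable lborel"
      by measurable
    then have "(\<lambda>t::real. (1 - cos t) / t powr \<alpha>) \<in> borel_measurable lebesgue"
      by (rule measurable_completion)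
    then show "(\<lambda>t. (1 - cos t) / t powr \<alpha>) \<in> borel_measurable (lebesgue_on {0..x})"
      by (rule measurable_restrict_space1)
    show "(\<lambda>t. t powr (2 - \<alpha>)) integrable_on {0..x}"
      using assms True by (intro integrable_on_powr_from_0) auto
    show "\<bar>(1 - cos t) / t powr \<alpha>\<bar> \<le> t powr (2 - \<alpha>)" if "t \<in> {0..x}" for t
    proof (cases "t = 0")
      case False
      then have t: "t > 0" using that by auto
      have "\<bar>(1 - cos t) / t powr \<alpha>\<bar> = (1 - cos t) / t powr \<alpha>"
        by (simp add: abs_of_nonneg)
      also have "\<dots> \<le> t\<^sup>2 / t powr \<alpha>"
      proof (rule divide_right_mono)
        show "1 - cos t \<le> t\<^sup>2"
          using one_minus_cos_le_half_square[of t] zero_le_power2[of t] by linarith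
      qed simp
      also have "\<dots> = t powr (2 - \<alpha>)"
        using t by (simp add: powr_diff)
      finally show ?thesis .
    qed auto
  qed auto
qed auto

lemma osc_int_has_derivative:
  assumes "\<alpha> < 3" "x > 0"
  shows "(osc_int \<alpha> has_real_derivative (1 - cos x) / x powr \<alpha>) (at x)"
proof -
  have "isCont (\<lambda>t. (1 - cos t) / t powr \<alpha>) x"
    using assms by (intro continuous_intros) auto
  then have "continuous (at x within ({0..x+1} - {})) (\<lambda>t. (1 - cos t) / t powr \<alpha>)"
    by (rule continuous_at_imp_continuous_at_within)
  then have "((\<lambda>u. integral {0..u} (\<lambda>t. (1 - cos t) / t powr \<alpha>))
          has_vector_derivative (1 - cos x) / x powr \<alpha>) (at x within ({0..x+1} - {}))"
    using assms
    by (intro integral_has_vector_derivative_continuous_at[where S = "{}"] osc_integrable) auto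
  moreover have "at x within ({0..x+1} - {}) = at x"
    using assms by (simp add: at_within_Icc_at)
  ultimately show ?thesis
    by (simp add: osc_int_def[abs_def] has_real_derivative_iff_has_vector_derivative)
qed

lemma osc_int_mono:
  assumes "\<alpha> < 3" "0 < x" "x \<le> y"
  shows "osc_int \<alpha> x \<le> osc_int \<alpha> y"
proof (rule DERIV_nonneg_imp_nondecreasing[OF \<open>x \<le> y\<close>])
  fix t assume "x \<le> t" "t \<le> y"
  then have "(osc_int \<alpha> has_real_derivative (1 - cos t) / t powr \<alpha>) (at t)"
    using assms by (intro osc_int_has_derivative) auto
  moreover have "0 \<le> (1 - cos t) / t powr \<alpha>" by simp
  ultimately show "\<exists>D. (osc_int \<alpha> has_real_derivative D) (at t) \<and> 0 \<le> D" by auto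
qed

text \<open>
  The integrand vanishes at multiples of \<open>2 * pi\<close>, so strict growth is taken from a subinterval
  of \<open>(0, 1]\<close>.
\<close>
lemma osc_int_pos:
  assumes "\<alpha> < 3" "x > 0"
  shows "osc_int \<alpha> x > 0"
proof -
  define y where "y = min x 1"
  have y: "0 < y" "y \<le> 1" "y \<le> x" using assms by (auto simp: y_def)
  have "0 \<le> osc_int \<alpha> (y/2)"
    unfolding osc_int_def by (rule integral_nonneg[OF osc_integrable[OF assms(1)]]) auto
  also have "\<dots> < osc_int \<alpha> y"
  proof (rule DERIV_pos_imp_increasing[where f = "osc_int \<alpha>"])
    fix t assume t: "y / 2 \<le> t" "t \<le> y"
    have "cos t < cos 0"
      by (rule cos_monotone_0_pi) (use t y pi_gt3 in auto)
    then have "0 < (1 - cos t) / t powr \<alpha>" using t y by simp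
    moreover have "(osc_int \<alpha> has_real_derivative (1 - cos t) / t powr \<alpha>) (at t)"
      using t y assms by (intro osc_int_has_derivative) auto
    ultimately show "\<exists>D. (osc_int \<alpha> has_real_derivative D) (at t) \<and> 0 < D" by blast
  qed (use y in auto)
  also have "\<dots> \<le> osc_int \<alpha> x" using assms y by (intro osc_int_mono) auto
  finally show ?thesis .
qed

text \<open>
  The integrand is at most \<open>2 / t powr \<alpha>\<close>, whose tail integral is the second summand. Stated as a
  monotonicity property: adding that tail to \<open>osc_int\<close> yields a function with derivative
  \<open>(- 1 - cos t) / t powr \<alpha>\<close>.
\<close>
lemma osc_int_increment_le:
  assumes "1 < \<alpha>" "\<alpha> < 3" "0 < x" "x \<le> y"
  shows "osc_int \<alpha> y \<le> osc_int \<alpha> x + 2 / (\<alpha> - 1) * x powr (1 - \<alpha>)"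
proof -
  have "osc_int \<alpha> y + 2 / (\<alpha> - 1) * y powr (1 - \<alpha>) \<le> osc_int \<alpha> x + 2 / (\<alpha> - 1) * x powr (1 - \<alpha>)"
  proof (rule DERIV_nonpos_imp_nonincreasing[OF \<open>x \<le> y\<close>,
        where f = "\<lambda>t. osc_int \<alpha> t + 2 / (\<alpha> - 1) * t powr (1 - \<alpha>)"])
    fix t assume t: "x \<le> t" "t \<le> y"
    then have tp: "t > 0" using assms by simp
    have "((\<lambda>t. osc_int \<alpha> t + 2 / (\<alpha> - 1) * t powr (1 - \<alpha>)) has_real_derivative
            (1 - cos t) / t powr \<alpha> + 2 / (\<alpha> - 1) * ((1 - \<alpha>) * t powr (1 - \<alpha> - 1))) (at t)"
      using tp assms
      by (intro DERIV_add DERIV_cmult osc_int_has_derivative has_real_derivative_powr) auto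
    moreover have "(1 - cos t) / t powr \<alpha> + 2 / (\<alpha> - 1) * ((1 - \<alpha>) * t powr (1 - \<alpha> - 1))
                     = (- 1 - cos t) / t powr \<alpha>"
    proof -
      have "2 / (\<alpha> - 1) * ((1 - \<alpha>) * t powr (1 - \<alpha> - 1)) = - 2 * t powr (- \<alpha>)"
      proof -
        have "2 / (\<alpha> - 1) * (1 - \<alpha>) = - 2" using assms by (simp add: field_simps)
        then show ?thesis by (simp add: mult.assoc[symmetric])
      qed
      then show ?thesis using tp by (simp only:) (simp add: powr_minus field_simps)
    qed
    moreover have "(- 1 - cos t) / t powr \<alpha> \<le> 0"
      using cos_ge_minus_one[of t] by (intro divide_nonpos_nonneg) auto
    ultimately show "\<exists>D. ((\<lambda>t. osc_int \<alpha> t + 2 / (\<alpha> - 1) * t powr (1 - \<alpha>))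
        has_real_derivative D) (at t) \<and> D \<le> 0" by auto
  qed
  moreover have "0 \<le> 2 / (\<alpha> - 1) * y powr (1 - \<alpha>)" using assms by simp
  ultimately show ?thesis by linarith
qed

lemma osc_int_le_limit:
  assumes "1 < \<alpha>" "\<alpha> < 3" "0 < x"
  shows "osc_int \<alpha> x \<le> osc_limit \<alpha>"
proof -
  have "bdd_above (osc_int \<alpha> ` {1..})"
    using osc_int_increment_le[OF assms(1,2), of 1]
    by (intro bdd_aboveI[where M = "osc_int \<alpha> 1 + 2 / (\<alpha> - 1) * 1 powr (1 - \<alpha>)"]) auto
  then have "osc_int \<alpha> (max 1 x) \<le> osc_limit \<alpha>"
    unfolding osc_limit_def by (intro cSUP_upper) auto
  moreover have "osc_int \<alpha> x \<le> osc_int \<alpha> (max 1 x)"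
    using assms by (intro osc_int_mono) auto
  ultimately show ?thesis by linarith
qed

text \<open>
  Together with \<open>osc_int_le_limit\<close> this is the rate of convergence that the expansion of the
  derivative rests on.
\<close>
lemma osc_limit_le:
  assumes "1 < \<alpha>" "\<alpha> < 3" "0 < x"
  shows "osc_limit \<alpha> \<le> osc_int \<alpha> x + 2 / (\<alpha> - 1) * x powr (1 - \<alpha>)"
  unfolding osc_limit_def
proof (rule cSUP_least)
  fix y :: real assume "y \<in> {1..}"
  have "osc_int \<alpha> y \<le> osc_int \<alpha> (max x y)"
    using assms \<open>y \<in> {1..}\<close> by (intro osc_int_mono) auto
  also have "\<dots> \<le> osc_int \<alpha> x + 2 / (\<alpha> - 1) * x powr (1 - \<alpha>)"
    using assms by (intro osc_int_increment_le) auto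
  finally show "osc_int \<alpha> y \<le> osc_int \<alpha> x + 2 / (\<alpha> - 1) * x powr (1 - \<alpha>)" .
qed auto

lemma osc_limit_pos:
  assumes "1 < \<alpha>" "\<alpha> < 3"
  shows "osc_limit \<alpha> > 0"
  using osc_int_pos[of \<alpha> 1] osc_int_le_limit[of \<alpha> 1] assms by linarith

section \<open>The derivative of a reciprocal eigenvalue\<close>

text \<open>
  The factor of the \<open>\<delta>\<close>-derivative of \<open>1 / eigval \<alpha> \<delta> n\<close> that depends on \<open>n\<close> and \<open>\<delta>\<close> through
  \<open>x = n * \<delta>\<close> alone: the first summand comes from the power of \<open>\<delta>\<close>, the second from the upper limit
  of the integral.
\<close>
definition profile :: "real \<Rightarrow> real \<Rightarrow> real" where
  "profile \<alpha> x = (3 - \<alpha>) / osc_int \<alpha> x - x powr (1 - \<alpha>) * (1 - cos x) / (osc_int \<alpha> x)\<^sup>2"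

definition deriv_recip_eigval :: "real \<Rightarrow> real \<Rightarrow> real \<Rightarrow> real" where
  "deriv_recip_eigval \<alpha> d n = d powr (2 - \<alpha>) / (2 * (3 - \<alpha>)) * n powr (1 - \<alpha>) * profile \<alpha> (n * d)"

lemma recip_eigval_eq:
  assumes "d > 0" "n > 0"
  shows "1 / eigval \<alpha> d n = n powr (1 - \<alpha>) / (2 * (3 - \<alpha>)) * (d powr (3 - \<alpha>) / osc_int \<alpha> (n * d))"
proof -
  have "n powr (1 - \<alpha>) = inverse (n powr (\<alpha> - 1))" "d powr (3 - \<alpha>) = inverse (d powr (- (3 - \<alpha>)))"
    by (simp_all add: powr_minus[symmetric])
  then show ?thesis
    unfolding eigval_def osc_int_def[symmetric] by (simp add: field_simps)
qed

lemma recip_eigval_has_derivative: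
  assumes "\<alpha> < 3" "d > 0" "n > 0"
  shows "((\<lambda>d. 1 / eigval \<alpha> d n) has_real_derivative deriv_recip_eigval \<alpha> d n) (at d)"
proof -
  define x where "x = n * d"
  have x: "x > 0" and I: "osc_int \<alpha> x > 0" using assms by (auto simp: x_def intro: osc_int_pos)
  have I': "((\<lambda>d. osc_int \<alpha> (n * d)) has_real_derivative (1 - cos x) / x powr \<alpha> * n) (at d)"
    using DERIV_chain2[where f = "osc_int \<alpha>" and g = "\<lambda>d. n * d" and x = d and s = UNIV,
        OF osc_int_has_derivative[OF \<open>\<alpha> < 3\<close> x, unfolded x_def], of n]
    by (auto simp: x_def intro!: derivative_eq_intros)
  have "((\<lambda>d. n powr (1 - \<alpha>) / (2 * (3 - \<alpha>)) * (d powr (3 - \<alpha>) / osc_int \<alpha> (n * d))) has_real_derivative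
      n powr (1 - \<alpha>) / (2 * (3 - \<alpha>)) *
        (((3 - \<alpha>) * d powr (3 - \<alpha> - 1) * osc_int \<alpha> (n * d) - d powr (3 - \<alpha>) * ((1 - cos x) / x powr \<alpha> * n))
          / (osc_int \<alpha> (n * d) * osc_int \<alpha> (n * d)))) (at d)"
    using assms I
    by (intro DERIV_cmult DERIV_divide I' has_real_derivative_powr) (auto simp: x_def)
  also have "n powr (1 - \<alpha>) / (2 * (3 - \<alpha>)) *
        (((3 - \<alpha>) * d powr (3 - \<alpha> - 1) * osc_int \<alpha> (n * d) - d powr (3 - \<alpha>) * ((1 - cos x) / x powr \<alpha> * n))
          / (osc_int \<alpha> (n * d) * osc_int \<alpha> (n * d))) = deriv_recip_eigval \<alpha> d n"
  proof -
    have "d powr (3 - \<alpha>) = d powr (2 - \<alpha>) * d"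
      using powr_add[of d "2 - \<alpha>" 1] assms by simp
    then have "d powr (3 - \<alpha>) * ((1 - cos x) / x powr \<alpha> * n) = d powr (2 - \<alpha>) * (1 - cos x) * (x / x powr \<alpha>)"
      by (simp add: x_def)
    also have "x / x powr \<alpha> = x powr (1 - \<alpha>)" using x by (simp add: powr_diff)
    finally have 1: "d powr (3 - \<alpha>) * ((1 - cos x) / x powr \<alpha> * n)
      = d powr (2 - \<alpha>) * (1 - cos x) * x powr (1 - \<alpha>)" .
    show ?thesis
      unfolding 1 deriv_recip_eigval_def profile_def x_def[symmetric]
      using I assms by (simp add: field_simps power2_eq_square)
  qed
  finally have "((\<lambda>d. n powr (1 - \<alpha>) / (2 * (3 - \<alpha>)) * (d powr (3 - \<alpha>) / osc_int \<alpha> (n * d)))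
     has_real_derivative deriv_recip_eigval \<alpha> d n) (at d)" .
  then show ?thesis
    by (rule has_field_derivative_transform_within_open[where S = "{0<..}"])
       (use assms in \<open>auto simp: recip_eigval_eq\<close>)
qed

text \<open>
  The oscillating second summand is bounded by its amplitude, and replacing \<open>osc_int\<close> by its limit in
  the first costs an error of the same order \<open>x powr (1 - \<alpha>)\<close>. The lower bound \<open>r\<close> keeps \<open>osc_int\<close>
  away from zero in the denominators.
\<close>
lemma profile_asymptotics:
  assumes "1 < \<alpha>" "\<alpha> < 3" "0 < r"
  obtains K where "K > 0"
    "\<And>x. r \<le> x \<Longrightarrow> \<bar>profile \<alpha> x - (3 - \<alpha>) / osc_limit \<alpha>\<bar> \<le> K * x powr (1 - \<alpha>)"
proof
  define I where "I = osc_int \<alpha> r"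
  have I: "I > 0" unfolding I_def using assms by (intro osc_int_pos) auto
  define K where "K = ((3 - \<alpha>) * (2 / (\<alpha> - 1)) + 2) / I\<^sup>2"
  show "K > 0" using assms I unfolding K_def by (intro divide_pos_pos add_nonneg_pos) auto
  fix x assume x: "r \<le> x"
  define J where "J = osc_int \<alpha> x"
  define L where "L = osc_limit \<alpha>"
  have x0: "x > 0" using x assms by simp
  have IJ: "I \<le> J" unfolding I_def J_def using assms x by (intro osc_int_mono) auto
  have JL: "J \<le> L" unfolding J_def L_def using assms x by (intro osc_int_le_limit) auto
  have LJ: "L - J \<le> 2 / (\<alpha> - 1) * x powr (1 - \<alpha>)"
    unfolding J_def L_def using osc_limit_le[OF assms(1,2) x0] by simp
  have J0: "J > 0" "L > 0" using I IJ JL by auto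
  have "\<bar>(3 - \<alpha>) / J - (3 - \<alpha>) / L\<bar> = (3 - \<alpha>) * (L - J) / (J * L)"
  proof -
    have "(3 - \<alpha>) / J - (3 - \<alpha>) / L = (3 - \<alpha>) * (L - J) / (J * L)"
      using J0 by (simp add: field_simps)
    then show ?thesis using J0 JL assms by simp
  qed
  also have "\<dots> \<le> (3 - \<alpha>) * (2 / (\<alpha> - 1) * x powr (1 - \<alpha>)) / I\<^sup>2"
    unfolding power2_eq_square
    using assms LJ IJ JL I by (intro frac_le mult_left_mono mult_mono mult_nonneg_nonneg) auto
  finally have 1: "\<bar>(3 - \<alpha>) / J - (3 - \<alpha>) / L\<bar> \<le> (3 - \<alpha>) * (2 / (\<alpha> - 1) * x powr (1 - \<alpha>)) / I\<^sup>2" .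
  have "\<bar>x powr (1 - \<alpha>) * (1 - cos x) / J\<^sup>2\<bar> = x powr (1 - \<alpha>) * (1 - cos x) / J\<^sup>2"
    by (simp add: abs_of_nonneg)
  also have "\<dots> \<le> x powr (1 - \<alpha>) * 2 / I\<^sup>2"
  proof (intro frac_le mult_left_mono)
    show "1 - cos x \<le> 2" using cos_ge_minus_one[of x] by linarith
    show "I\<^sup>2 \<le> J\<^sup>2" using I IJ by (intro power_mono) auto
  qed (use I in auto)
  finally have 2: "\<bar>x powr (1 - \<alpha>) * (1 - cos x) / J\<^sup>2\<bar> \<le> x powr (1 - \<alpha>) * 2 / I\<^sup>2" .
  have "\<bar>profile \<alpha> x - (3 - \<alpha>) / L\<bar>
      \<le> (3 - \<alpha>) * (2 / (\<alpha> - 1) * x powr (1 - \<alpha>)) / I\<^sup>2 + x powr (1 - \<alpha>) * 2 / I\<^sup>2"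
    using 1 2 unfolding profile_def J_def[symmetric] by linarith
  also have "\<dots> = K * x powr (1 - \<alpha>)"
    unfolding K_def by (simp add: add_divide_distrib algebra_simps)
  finally show "\<bar>profile \<alpha> x - (3 - \<alpha>) / osc_limit \<alpha>\<bar> \<le> K * x powr (1 - \<alpha>)"
    unfolding L_def .
qed

section \<open>Differentiating the series\<close>

abbreviation weight :: "real \<Rightarrow> nat \<Rightarrow> real" where
  "weight \<omega> k \<equiv> (sin (real (Suc k) * pi * \<omega>) / real (Suc k))\<^sup>2"

definition dF :: "real \<Rightarrow> nat \<Rightarrow> real \<Rightarrow> real \<Rightarrow> real" where
  "dF \<alpha> N \<delta> \<omega> = (\<Sum>k. deriv_recip_eigval \<alpha> \<delta> (real (Suc k) * real N) * weight \<omega> k)"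

lemma weight_le: "weight \<omega> k \<le> 1 / real ((k + 1)\<^sup>2)"
proof -
  have "(sin (real (Suc k) * pi * \<omega>))\<^sup>2 \<le> 1\<^sup>2"
    using abs_sin_le_one by (simp add: abs_square_le_1)
  then show ?thesis by (simp add: power_divide divide_right_mono)
qed

lemma bounded_mult_weight_le:
  assumes "\<bar>b\<bar> \<le> B"
  shows "norm (b * weight \<omega> k) \<le> B * (1 / real ((k + 1)\<^sup>2))"
  unfolding real_norm_def abs_mult
  using assms weight_le[of k \<omega>] by (intro mult_mono) auto

lemma summable_bounded_mult_weight:
  assumes "\<And>k. \<bar>b k\<bar> \<le> B"
  shows "summable (\<lambda>k. b k * weight \<omega> k)"
  using summable_mult[OF sums_summable[OF inverse_squares_sums], of B] bounded_mult_weight_le[OF assms]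
  by (rule summable_comparison_test'[where N = 0])

lemma powr_nonpos_le_one:
  assumes "1 \<le> (x::real)" "a \<le> 0"
  shows "x powr a \<le> 1"
  using powr_mono[of a 0 x] assms by simp

lemma mode_ge_one: "N \<ge> 1 \<Longrightarrow> 1 \<le> real (Suc k) * real N"
  using mult_mono[of 1 "real (Suc k)" 1 "real N"] by simp

text \<open>
  The terms are differentiated one by one. On \<open>d > \<delta>/2\<close> all arguments \<open>m * N * d\<close> stay above
  \<open>\<delta>/2\<close>, where \<open>profile\<close> is bounded, and the powers of \<open>d\<close> and \<open>m * N\<close> have negative exponents; so \<open>1 / m\<^sup>2\<close> times a constant dominates the differentiated
  series uniformly.
\<close>
lemma F_has_derivative:
  assumes "2 < \<alpha>" "\<alpha> < 3" "0 < \<delta>" "1 \<le> N"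
  shows "((\<lambda>d. F \<alpha> N d \<omega>) has_real_derivative dF \<alpha> N \<delta> \<omega>) (at \<delta>)"
proof -
  define S where "S = {\<delta>/2<..}"
  have mode: "1 \<le> real (Suc k) * real N" for k using assms by (intro mode_ge_one)
  have mode_pos: "0 < real (Suc k) * real N" for k using mode[of k] by linarith
  have scale: "r \<le> real (Suc k) * real N * d" if "r \<le> d" "0 < r" for k r d
    using mult_mono[OF mode[of k] that(1)] that by simp
  obtain K where K: "K > 0" and
    K_bound: "\<And>x. \<delta>/2 \<le> x \<Longrightarrow> \<bar>profile \<alpha> x - (3 - \<alpha>) / osc_limit \<alpha>\<bar> \<le> K * x powr (1 - \<alpha>)"
    using profile_asymptotics[of \<alpha> "\<delta>/2"] assms by auto
  define P where "P = (3 - \<alpha>) / osc_limit \<alpha> + K * (\<delta>/2) powr (1 - \<alpha>)"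
  have P0: "0 \<le> (3 - \<alpha>) / osc_limit \<alpha>" using osc_limit_pos[of \<alpha>] assms by simp
  have P: "\<bar>profile \<alpha> x\<bar> \<le> P" if "\<delta>/2 \<le> x" for x
  proof -
    have "x powr (1 - \<alpha>) \<le> (\<delta>/2) powr (1 - \<alpha>)"
      using assms that by (intro powr_mono2') auto
    then have "K * x powr (1 - \<alpha>) \<le> K * (\<delta>/2) powr (1 - \<alpha>)" using K by simp
    then show ?thesis using K_bound[OF that] P0 unfolding P_def by linarith
  qed
  define B where "B = (\<delta>/2) powr (2 - \<alpha>) / (2 * (3 - \<alpha>)) * 1 * P"
  have B: "\<bar>deriv_recip_eigval \<alpha> d (real (Suc k) * real N)\<bar> \<le> B" if "d \<in> S" for d k
    unfolding deriv_recip_eigval_def abs_mult B_def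
  proof (intro mult_mono)
    show "\<bar>d powr (2 - \<alpha>) / (2 * (3 - \<alpha>))\<bar> \<le> (\<delta>/2) powr (2 - \<alpha>) / (2 * (3 - \<alpha>))"
      using assms that powr_mono2'[of "2 - \<alpha>" "\<delta>/2" d] by (auto simp: S_def divide_right_mono)
    show "\<bar>(real (Suc k) * real N) powr (1 - \<alpha>)\<bar> \<le> 1"
      using powr_nonpos_le_one[OF mode] assms by simp
    show "\<bar>profile \<alpha> (real (Suc k) * real N * d)\<bar> \<le> P"
      using that assms by (intro P scale) (auto simp: S_def)
  qed (use assms in auto)
  have "((\<lambda>d. \<Sum>k. 1 / eigval \<alpha> d (real (Suc k) * real N) * weight \<omega> k) has_field_derivative
      (\<Sum>k. deriv_recip_eigval \<alpha> \<delta> (real (Suc k) * real N) * weight \<omega> k)) (at \<delta>)"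
  proof (rule has_field_derivative_series'(2)[where S = S and ?x0.0 = \<delta>])
    show "convex S" unfolding S_def by (rule convex_real_interval)
    show "\<delta> \<in> S" "\<delta> \<in> interior S" using assms by (auto simp: S_def interior_open)
    show "((\<lambda>d. 1 / eigval \<alpha> d (real (Suc k) * real N) * weight \<omega> k) has_real_derivative
             deriv_recip_eigval \<alpha> d (real (Suc k) * real N) * weight \<omega> k) (at d within S)"
      if "d \<in> S" for k d
      using that assms mode_pos[of k]
      by (intro has_field_derivative_at_within[OF DERIV_cmult_right] recip_eigval_has_derivative)
         (auto simp: S_def)
    show "uniformly_convergent_on S
        (\<lambda>n d. \<Sum>k<n. deriv_recip_eigval \<alpha> d (real (Suc k) * real N) * weight \<omega> k)"
      by (rule Weierstrass_m_test'[OF bounded_mult_weight_le[OF B]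
                 summable_mult[OF sums_summable[OF inverse_squares_sums]]])
    show "summable (\<lambda>k. 1 / eigval \<alpha> \<delta> (real (Suc k) * real N) * weight \<omega> k)"
    proof (rule summable_bounded_mult_weight)
      fix k
      let ?n = "real (Suc k) * real N"
      have J: "0 < osc_int \<alpha> \<delta>" "osc_int \<alpha> \<delta> \<le> osc_int \<alpha> (?n * \<delta>)"
        using assms scale[of \<delta> \<delta> k] by (auto intro!: osc_int_pos osc_int_mono)
      have "\<bar>1 / eigval \<alpha> \<delta> ?n\<bar> = ?n powr (1 - \<alpha>) / (2 * (3 - \<alpha>)) * (\<delta> powr (3 - \<alpha>) / osc_int \<alpha> (?n * \<delta>))"
        unfolding recip_eigval_eq[OF \<open>0 < \<delta>\<close> mode_pos]
        using assms J by (intro abs_of_nonneg mult_nonneg_nonneg divide_nonneg_nonneg) auto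
      also have "\<dots> \<le> 1 / (2 * (3 - \<alpha>)) * (\<delta> powr (3 - \<alpha>) / osc_int \<alpha> \<delta>)"
        using assms J powr_nonpos_le_one[OF mode[of k]]
        by (intro mult_mono frac_le) auto
      finally show "\<bar>1 / eigval \<alpha> \<delta> ?n\<bar> \<le> 1 / (2 * (3 - \<alpha>)) * (\<delta> powr (3 - \<alpha>) / osc_int \<alpha> \<delta>)" .
    qed
  qed
  then show ?thesis unfolding F_def dF_def .
qed

section \<open>Large frequencies\<close>

text \<open>
  With \<open>x = m * N * \<delta>\<close> the constant part of \<open>profile\<close> contributes the main term, as \<open>N powr (1 - \<alpha>)\<close>
  factors out of the series; the remainder brings in a further factor \<open>N powr (1 - \<alpha>)\<close>. The constant \<open>A\<close>
  is positive because the weight of the mode \<open>m = 1\<close> is \<open>(sin (pi * \<omega>))\<^sup>2 > 0\<close>.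
\<close>
lemma dF_asymptotics:
  assumes "2 < \<alpha>" "\<alpha> < 3" "0 < \<delta>" "0 < \<omega>" "\<omega> < 1"
  obtains A B where "A > 0" "B > 0"
    "\<And>N. 1 \<le> N \<Longrightarrow> \<bar>dF \<alpha> N \<delta> \<omega> - A * real N powr (1 - \<alpha>)\<bar> \<le> B * real N powr (2 * (1 - \<alpha>))"
proof -
  define c where "c = (3 - \<alpha>) / osc_limit \<alpha>"
  define D where "D = \<delta> powr (2 - \<alpha>) / (2 * (3 - \<alpha>))"
  define q where "q = (\<lambda>k. real (Suc k) powr (1 - \<alpha>) * weight \<omega> k)"
  have c: "c > 0" unfolding c_def using assms osc_limit_pos[of \<alpha>] by simp
  have D: "D > 0" unfolding D_def using assms by simp
  obtain K where K: "K > 0" and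
    K_bound: "\<And>x. \<delta> \<le> x \<Longrightarrow> \<bar>profile \<alpha> x - c\<bar> \<le> K * x powr (1 - \<alpha>)"
    using profile_asymptotics[of \<alpha> \<delta>] assms unfolding c_def by auto
  have q_nonneg: "0 \<le> q k" for k unfolding q_def by simp
  have q_sum: "summable q"
    unfolding q_def using assms powr_nonpos_le_one
    by (intro summable_bounded_mult_weight[where B = 1]) simp
  have "0 < q 0"
  proof -
    have "0 < sin (pi * \<omega>)" using assms by (intro sin_gt_zero) auto
    then show ?thesis by (simp add: q_def)
  qed
  then have S: "suminf q > 0" using suminf_pos2[OF q_sum q_nonneg] by blast
  define A where "A = D * c * suminf q"
  define B where "B = D * K * \<delta> powr (1 - \<alpha>) * suminf q"
  have AB: "A > 0" "B > 0" using S D c K assms by (auto simp: A_def B_def)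
  have "\<bar>dF \<alpha> N \<delta> \<omega> - A * real N powr (1 - \<alpha>)\<bar> \<le> B * real N powr (2 * (1 - \<alpha>))"
    if N: "1 \<le> N" for N
  proof -
    have term_eq: "deriv_recip_eigval \<alpha> \<delta> (real (Suc k) * real N) * weight \<omega> k
        = D * real N powr (1 - \<alpha>) * q k * profile \<alpha> (real (Suc k) * real N * \<delta>)" for k
      unfolding deriv_recip_eigval_def D_def q_def by (simp add: powr_mult)
    \<comment> \<open>The terms left over after subtracting the constant part \<open>c\<close> of \<open>profile\<close>.\<close>
    define g where "g = (\<lambda>k. D * real N powr (1 - \<alpha>) * q k * (profile \<alpha> (real (Suc k) * real N * \<delta>) - c))"
    have g_bound: "\<bar>g k\<bar> \<le> D * K * \<delta> powr (1 - \<alpha>) * real N powr (2 * (1 - \<alpha>)) * q k" for k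
    proof -
      let ?x = "real (Suc k) * real N * \<delta>"
      have m: "1 * \<delta> \<le> ?x" using mode_ge_one[OF N, of k] assms by (intro mult_right_mono) auto
      have "\<bar>profile \<alpha> ?x - c\<bar> \<le> K * ?x powr (1 - \<alpha>)" using m by (intro K_bound) simp
      also have "?x powr (1 - \<alpha>) = real (Suc k) powr (1 - \<alpha>) * (real N powr (1 - \<alpha>) * \<delta> powr (1 - \<alpha>))"
        using assms by (simp add: powr_mult mult.assoc)
      also have "\<dots> \<le> 1 * (real N powr (1 - \<alpha>) * \<delta> powr (1 - \<alpha>))"
        using assms by (intro mult_right_mono powr_nonpos_le_one) auto
      finally have "\<bar>profile \<alpha> ?x - c\<bar> \<le> K * (real N powr (1 - \<alpha>) * \<delta> powr (1 - \<alpha>))"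
        using K by simp
      then have "\<bar>g k\<bar> \<le> D * real N powr (1 - \<alpha>) * q k * (K * (real N powr (1 - \<alpha>) * \<delta> powr (1 - \<alpha>)))"
        unfolding g_def abs_mult using D q_nonneg[of k] by (intro mult_mono) auto
      also have "\<dots> = D * K * \<delta> powr (1 - \<alpha>) * (real N powr (1 - \<alpha>) * real N powr (1 - \<alpha>)) * q k"
        by (simp add: algebra_simps)
      also have "real N powr (1 - \<alpha>) * real N powr (1 - \<alpha>) = real N powr (2 * (1 - \<alpha>))"
        by (simp add: powr_add[symmetric])
      finally show ?thesis .
    qed
    have bound_sum: "summable (\<lambda>k. D * K * \<delta> powr (1 - \<alpha>) * real N powr (2 * (1 - \<alpha>)) * q k)"
      by (rule summable_mult[OF q_sum])
    have g_abs_sum: "summable (\<lambda>k. \<bar>g k\<bar>)"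
      by (rule summable_comparison_test'[OF bound_sum, where N = 0]) (use g_bound in auto)
    have g_sum: "summable g" using g_abs_sum by (rule summable_rabs_cancel)
    have "dF \<alpha> N \<delta> \<omega> = (\<Sum>k. D * real N powr (1 - \<alpha>) * c * q k + g k)"
      unfolding dF_def term_eq g_def by (simp add: algebra_simps)
    also have "\<dots> = D * real N powr (1 - \<alpha>) * c * suminf q + suminf g"
      by (subst suminf_add[symmetric, OF summable_mult[OF q_sum] g_sum]) (simp add: suminf_mult[OF q_sum])
    finally have "dF \<alpha> N \<delta> \<omega> - A * real N powr (1 - \<alpha>) = suminf g"
      unfolding A_def by (simp add: algebra_simps)
    moreover have "\<bar>suminf g\<bar> \<le> (\<Sum>k. \<bar>g k\<bar>)"
      using g_abs_sum by (rule summable_rabs)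
    moreover have "\<dots> \<le> (\<Sum>k. D * K * \<delta> powr (1 - \<alpha>) * real N powr (2 * (1 - \<alpha>)) * q k)"
      by (rule suminf_le[OF g_bound g_abs_sum bound_sum])
    moreover have "\<dots> = B * real N powr (2 * (1 - \<alpha>))"
      unfolding B_def by (subst suminf_mult[OF q_sum]) (simp add: algebra_simps)
    ultimately show ?thesis
      by simp
  qed
  with AB show ?thesis by (rule that)
qed

lemma powr_decrement_ge:
  assumes "1 < (\<alpha>::real)" "0 < x"
  shows "(\<alpha> - 1) * (x + 1) powr (- \<alpha>) \<le> x powr (1 - \<alpha>) - (x + 1) powr (1 - \<alpha>)"
proof -
  have "\<exists>z. x < z \<and> z < x + 1 \<and> (x + 1) powr (1 - \<alpha>) - x powr (1 - \<alpha>)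
          = (x + 1 - x) * ((1 - \<alpha>) * z powr (1 - \<alpha> - 1))"
    using assms by (intro MVT2 has_real_derivative_powr) auto
  then obtain z where z: "x < z" "z < x + 1"
    and eq: "(x + 1) powr (1 - \<alpha>) - x powr (1 - \<alpha>) = (1 - \<alpha>) * z powr (- \<alpha>)"
    by auto
  have "(x + 1) powr (- \<alpha>) \<le> z powr (- \<alpha>)"
    using z assms by (intro powr_mono2') auto
  then have "(\<alpha> - 1) * (x + 1) powr (- \<alpha>) \<le> (\<alpha> - 1) * z powr (- \<alpha>)"
    using assms by simp
  then show ?thesis using eq by (simp add: algebra_simps)
qed

text \<open>
  The main term loses at least a multiple of \<open>N powr (- \<alpha>)\<close> from \<open>N\<close> to \<open>N + 1\<close>. The two remainders are
  together at most \<open>2 * B * N powr (2 - \<alpha>) * N powr (- \<alpha>)\<close>, and \<open>N powr (2 - \<alpha>)\<close> tends to zero.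
\<close>
lemma eventually_increment_nonpos:
  fixes G :: "nat \<Rightarrow> real"
  assumes "2 < \<alpha>" "A > 0" "B > 0"
    and G: "\<And>N. 1 \<le> N \<Longrightarrow> \<bar>G N - A * real N powr (1 - \<alpha>)\<bar> \<le> B * real N powr (2 * (1 - \<alpha>))"
  shows "eventually (\<lambda>N. G (N + 1) - G N \<le> 0) sequentially"
proof -
  \<comment> \<open>The factor \<open>2 powr (- \<alpha>)\<close> turns \<open>N powr (- \<alpha>)\<close> into \<open>(2 * N) powr (- \<alpha>) \<le> (N + 1) powr (- \<alpha>)\<close>.\<close>
  define \<epsilon> where "\<epsilon> = A * (\<alpha> - 1) * 2 powr (- \<alpha>) / (2 * B)"
  have "\<epsilon> > 0" using assms by (simp add: \<epsilon>_def)
  have "(\<lambda>N. real N powr (2 - \<alpha>)) \<longlonglongrightarrow> 0"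
    using assms by (intro tendsto_neg_powr filterlim_real_sequentially) auto
  then have "eventually (\<lambda>N. real N powr (2 - \<alpha>) < \<epsilon>) sequentially"
    using \<open>\<epsilon> > 0\<close> by (rule order_tendstoD)
  then show ?thesis
    using eventually_ge_at_top[of 1]
  proof eventually_elim
    case (elim N)
    let ?x = "real N"
    have x: "1 \<le> ?x" using elim by simp
    have "B * (?x + 1) powr (2 * (1 - \<alpha>)) + B * ?x powr (2 * (1 - \<alpha>)) \<le> 2 * B * ?x powr (2 * (1 - \<alpha>))"
      using powr_mono2'[of "2 * (1 - \<alpha>)" ?x "?x + 1"] x assms by simp
    also have "2 * B * ?x powr (2 * (1 - \<alpha>)) = 2 * B * (?x powr (2 - \<alpha>) * ?x powr (- \<alpha>))"
      by (simp add: powr_add[symmetric] algebra_simps)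
    also have "2 * B * (?x powr (2 - \<alpha>) * ?x powr (- \<alpha>)) \<le> 2 * B * (\<epsilon> * ?x powr (- \<alpha>))"
      using elim assms by (intro mult_left_mono mult_right_mono) auto
    also have "\<dots> = A * (\<alpha> - 1) * (2 * ?x) powr (- \<alpha>)"
      using assms by (simp add: \<epsilon>_def powr_mult)
    also have "\<dots> \<le> A * (\<alpha> - 1) * (?x + 1) powr (- \<alpha>)"
      using x assms by (intro mult_left_mono powr_mono2') auto
    also have "\<dots> \<le> A * (?x powr (1 - \<alpha>) - (?x + 1) powr (1 - \<alpha>))"
      using powr_decrement_ge[of \<alpha> ?x] x assms by (simp add: mult.assoc)
    finally have "B * (?x + 1) powr (2 * (1 - \<alpha>)) + B * ?x powr (2 * (1 - \<alpha>))
        \<le> A * ?x powr (1 - \<alpha>) - A * (?x + 1) powr (1 - \<alpha>)" by (simp only: right_diff_distrib)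
    moreover have "\<bar>G (N + 1) - A * (?x + 1) powr (1 - \<alpha>)\<bar> \<le> B * (?x + 1) powr (2 * (1 - \<alpha>))"
      using G[of "N + 1"] by (simp add: add.commute)
    moreover have "\<bar>G N - A * ?x powr (1 - \<alpha>)\<bar> \<le> B * ?x powr (2 * (1 - \<alpha>))"
      using G[of N] elim by simp
    ultimately show ?case by linarith
  qed
qed

section \<open>Promotion of the splitting\<close>

theorem theorem3p6:
  fixes \<alpha> \<delta> \<omega> :: real
  assumes "2 < \<alpha>" and "\<alpha> < 3"
    and "0 < \<delta>" and "\<delta> \<le> pi"
    and "0 < \<omega>" and "\<omega> < 1 / 2"
  shows "\<exists>N0\<ge>2. \<forall>\<gamma>>0. Nstar \<alpha> \<omega> \<gamma> \<delta> \<ge> N0 \<longrightarrow>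
           dDeltaF \<alpha> (Nstar \<alpha> \<omega> \<gamma> \<delta> - 1) \<delta> \<omega> \<le> 0 \<and>
           dDeltaF \<alpha> (Nstar \<alpha> \<omega> \<gamma> \<delta>) \<delta> \<omega> \<le> 0 \<and>
           instantly_promotes \<alpha> \<omega> \<gamma> \<delta>"
proof -
  have deriv: "((\<lambda>d. DeltaF \<alpha> N d \<omega>) has_real_derivative dF \<alpha> (N + 1) \<delta> \<omega> - dF \<alpha> N \<delta> \<omega>) (at \<delta>)"
    if "1 \<le> N" for N
    unfolding DeltaF_def using assms that by (intro DERIV_diff F_has_derivative) auto
  obtain A B where "A > 0" "B > 0"
    "\<And>N. 1 \<le> N \<Longrightarrow> \<bar>dF \<alpha> N \<delta> \<omega> - A * real N powr (1 - \<alpha>)\<bar> \<le> B * real N powr (2 * (1 - \<alpha>))"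
    using dF_asymptotics[of \<alpha> \<delta> \<omega>] assms by auto
  then have "eventually (\<lambda>N. dF \<alpha> (N + 1) \<delta> \<omega> - dF \<alpha> N \<delta> \<omega> \<le> 0) sequentially"
    using eventually_increment_nonpos[of \<alpha> A B "\<lambda>N. dF \<alpha> N \<delta> \<omega>"] assms by blast
  then obtain M where M: "\<And>N. M \<le> N \<Longrightarrow> dF \<alpha> (N + 1) \<delta> \<omega> - dF \<alpha> N \<delta> \<omega> \<le> 0"
    unfolding eventually_sequentially by blast
  have large: "(\<lambda>d. DeltaF \<alpha> N d \<omega>) field_differentiable (at \<delta>) \<and> dDeltaF \<alpha> N \<delta> \<omega> \<le> 0"
    if "max 1 M \<le> N" for N
    using deriv[of N] M[of N] that DERIV_imp_deriv[OF deriv[of N]]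
    by (auto simp: field_differentiable_def dDeltaF_def)
  \<comment> \<open>The extra one in the threshold lets \<open>large\<close> apply to the predecessor of the minimizer as well.\<close>
  show ?thesis
  proof (intro exI[of _ "max 1 M + 1"] conjI allI impI)
    fix \<gamma> :: real
    assume "max 1 M + 1 \<le> Nstar \<alpha> \<omega> \<gamma> \<delta>"
    then have "max 1 M \<le> Nstar \<alpha> \<omega> \<gamma> \<delta> - 1" "max 1 M \<le> Nstar \<alpha> \<omega> \<gamma> \<delta>" by linarith+
    then show "dDeltaF \<alpha> (Nstar \<alpha> \<omega> \<gamma> \<delta> - 1) \<delta> \<omega> \<le> 0" "dDeltaF \<alpha> (Nstar \<alpha> \<omega> \<gamma> \<delta>) \<delta> \<omega> \<le> 0"
      "instantly_promotes \<alpha> \<omega> \<gamma> \<delta>"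
      unfolding instantly_promotes_def using large by blast+
  qed simp
qed

end
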